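(* Let $n\ge 1$ be an integer and let $P\subseteq[n]$ be an $n$-admissible pinnacle set. Then \[|\mathrm{Pin}(P;n)|=2^{n-|P|-1}\sum_{V\in \mathcal V(P)}\ \prod_{p \in P}\binom{N_{PV}(p)}{2}\prod_{x \in [n] \setminus (P \cup V)} N_{PV}(x).\]
   Context: $[n]=\{1,\dots,n\}$ and $\mathfrak S_n$ is the set of permutations $\pi=\pi_1\pi_2\cdots\pi_n$ of $[n]$ in one-line notation, with the convention $\pi_0=\pi_{n+1}=\infty$. For $i\in[n]$, the value $\pi_i$ is a pinnacle of $\pi$ if $\pi_{i-1}<\pi_i>\pi_{i+1}$, and a vale of $\pi$ if $\pi_{i-1}>\pi_i<\pi_{i+1}$. (So $\pi_1$ and $\pi_n$ are never pinnacles but may be vales.) $\mathrm{Pin}(\pi)$ is the set of pinnacles of $\pi$, and $\mathrm{Vale}(\pi)$ is the set of vales of $\pi$. $\mathrm{Pin}(P;n)=\{\pi\in\mathfrak S_n:\mathrm{Pin}(\pi)=P\}$; $P\subseteq[n]$ is an $n$-admissible pinnacle set if $\mathrm{Pin}(P;n)\neq\emptyset$. $\mathcal V(P)$ is the set of all $V\subseteq[n]\setminus P$ such that some $\pi\in\mathfrak S_n$ has $\mathrm{Pin}(\pi)=P$ and $\mathrm{Vale}(\pi)=V$. For $k\in[n]$ put $V_k=\{v\in V: v<k\}$, $P_k=\{p\in P:p<k\}$ and $N_{PV}(k)=|V_k|-|P_k|$. *)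

theory Defs
  imports Complex_Main "HOL-Combinatorics.Permutations" "HOL-Library.Extended_Nat"
begin

text \<open>
  A permutation of \<open>{1..n}\<close> in one-line notation is a function \<open>\<pi>\<close> with
  \<^term>\<open>\<pi> permutes {1..n}\<close>, the \<open>i\<close>-th letter being \<open>\<pi> i\<close>. (Such a \<open>\<pi>\<close> is the identity outside
  \<open>{1..n}\<close>, so these functions correspond one-to-one to the permutations of \<open>{1..n}\<close>.)
  The function \<open>letter\<close> replaces the values at the positions \<open>0\<close> and \<open>n + 1\<close> by infinity.
\<close>

definition letter :: "nat \<Rightarrow> (nat \<Rightarrow> nat) \<Rightarrow> nat \<Rightarrow> enat" where
  "letter n \<pi> i = (if i \<in> {1..n} then enat (\<pi> i) else \<infinity>)"

definition Pin :: "nat \<Rightarrow> (nat \<Rightarrow> nat) \<Rightarrow> nat set" where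
  "Pin n \<pi> = {\<pi> i | i. i \<in> {1..n} \<and>
     letter n \<pi> (i - 1) < letter n \<pi> i \<and> letter n \<pi> i > letter n \<pi> (i + 1)}"

definition Vale :: "nat \<Rightarrow> (nat \<Rightarrow> nat) \<Rightarrow> nat set" where
  "Vale n \<pi> = {\<pi> i | i. i \<in> {1..n} \<and>
     letter n \<pi> (i - 1) > letter n \<pi> i \<and> letter n \<pi> i < letter n \<pi> (i + 1)}"

definition Pin_perms :: "nat set \<Rightarrow> nat \<Rightarrow> (nat \<Rightarrow> nat) set" where
  "Pin_perms P n = {\<pi>. \<pi> permutes {1..n} \<and> Pin n \<pi> = P}"

definition admissible :: "nat \<Rightarrow> nat set \<Rightarrow> bool" where
  "admissible n P \<longleftrightarrow> P \<subseteq> {1..n} \<and> Pin_perms P n \<noteq> {}"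

definition vale_sets :: "nat \<Rightarrow> nat set \<Rightarrow> nat set set" where
  "vale_sets n P = {V. V \<subseteq> {1..n} - P \<and>
     (\<exists>\<pi>. \<pi> permutes {1..n} \<and> Pin n \<pi> = P \<and> Vale n \<pi> = V)}"

text \<open>The difference is taken in the integers, where it does not truncate.\<close>

definition N_PV :: "nat set \<Rightarrow> nat set \<Rightarrow> nat \<Rightarrow> int" where
  "N_PV P V k = int (card {v \<in> V. v < k}) - int (card {p \<in> P. p < k})"

end

theory Submission imports Defs
begin

text \<open>
  Build a permutation by inserting the letters \<open>1, 2, ..., n\<close> in this order. After \<open>k\<close> steps one
  sees the letters up to \<open>k\<close> grouped into maximal blocks of adjacent positions; the relative order
  of the blocks is irrelevant and is forgotten, so the state is a set of disjoint words
  (\<open>block_systems\<close>). The letter \<open>k + 1\<close> exceeds everything present, hence its shape in the final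
  permutation is decided by the way it is inserted. A vale starts a new block, a pinnacle has a
  block on either side and glues two blocks, and any other letter is attached to one end of one
  block. Deleting the largest letter from its block undoes the step, so every state with letters
  up to \<open>k + 1\<close> comes from exactly one insertion (\<open>join_at_inj\<close>, \<open>join_at_surj\<close>), and no
  later insertion changes the shape of an older letter (\<open>system_shape_join_at\<close>).

  Fix the set \<open>P\<close> of pinnacles and the set \<open>V\<close> of vales. A vale raises the number of blocks by
  one, a pinnacle lowers it by one, and the other letters preserve it; so just before the letter
  \<open>m\<close> is inserted there are \<open>N = N_PV P V m\<close> blocks (\<open>card_PV_system\<close>). The number of possible
  insertions is thus \<open>1\<close> for a vale, \<open>N (N - 1)\<close> for a pinnacle (an ordered pair of different
  blocks), and \<open>2 N\<close> otherwise, and the number of final states is the product of these factors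
  (\<open>card_PV_systems\<close>).

  A permutation is a final state with a single block. Its numbers of vales and pinnacles differ by
  one (\<open>card_Vale\<close>), and conversely that relation between \<open>V\<close> and \<open>P\<close> forces all final states
  to have a single block (\<open>card_perms_with_Pin_Vale\<close>). Each pinnacle contributes
  \<open>N (N - 1) = 2 * (N choose 2)\<close> and each letter that is neither pinnacle nor vale contributes
  \<open>2 N\<close>, so the power of two is \<open>n - card V = n - card P - 1\<close>. Summing over the possible vale
  sets \<open>V\<close> gives the formula.
\<close>

section \<open>Shapes of letters in a word\<close>

text \<open>
  \<open>Q\<close> is told whether the left and whether the right neighbour of a letter exists and is smaller.
  A missing neighbour counts as larger, as required by the convention that the border letters are
  infinite. Pinnacles and vales are the two instances of \<open>Q\<close> below, so that each fact about
  shapes is proved once for both.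
\<close>
definition letters_of_shape :: "(bool \<Rightarrow> bool \<Rightarrow> bool) \<Rightarrow> 'a::linorder list \<Rightarrow> 'a set" where
  "letters_of_shape Q w = {a. \<exists>xs ys. w = xs @ a # ys \<and>
     Q (xs \<noteq> [] \<and> last xs < a) (ys \<noteq> [] \<and> hd ys < a)}"

abbreviation (input) peak_shape :: "bool \<Rightarrow> bool \<Rightarrow> bool" where
  "peak_shape l r \<equiv> l \<and> r"

abbreviation (input) valley_shape :: "bool \<Rightarrow> bool \<Rightarrow> bool" where
  "valley_shape l r \<equiv> \<not> l \<and> \<not> r"

lemma letters_of_shape_Nil [simp]: "letters_of_shape Q [] = {}"
  by (simp add: letters_of_shape_def)

lemma letters_of_shape_subset: "letters_of_shape Q w \<subseteq> set w"
  by (auto simp: letters_of_shape_def)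

text \<open>
  A letter of \<open>xs\<close> that gains the neighbour \<open>m\<close> had no neighbour on that side before. A larger
  neighbour counts like a missing one, so old letters keep their shapes, while \<open>m\<close> itself sees a
  smaller neighbour exactly on the sides where there is a neighbour.
\<close>
lemma letters_of_shape_split_at_max:
  assumes "\<And>a. a \<in> set xs \<union> set ys \<Longrightarrow> a < m"
  shows "letters_of_shape Q (xs @ m # ys) =
    letters_of_shape Q xs \<union> letters_of_shape Q ys \<union> (if Q (xs \<noteq> []) (ys \<noteq> []) then {m} else {})"
    (is "?L = ?R")
proof (intro equalityI subsetI)
  fix a assume "a \<in> ?L"
  then obtain us vs where eq: "xs @ m # ys = us @ a # vs"
    and Q: "Q (us \<noteq> [] \<and> last us < a) (vs \<noteq> [] \<and> hd vs < a)"
    by (auto simp: letters_of_shape_def)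
  from eq consider (left) zs where "xs = us @ a # zs" "vs = zs @ m # ys"
    | (mid) "us = xs" "a = m" "vs = ys"
    | (right) zs where "us = xs @ m # zs" "ys = zs @ a # vs"
    by (auto simp: append_eq_append_conv2 append_eq_Cons_conv Cons_eq_append_conv)
  then show "a \<in> ?R"
  proof cases
    case left
    then have "(vs \<noteq> [] \<and> hd vs < a) = (zs \<noteq> [] \<and> hd zs < a)"
      using assms[of a] by (cases zs) auto
    with left Q show ?thesis by (auto simp: letters_of_shape_def)
  next
    case mid
    then have "(us \<noteq> [] \<and> last us < a) = (xs \<noteq> [])" "(vs \<noteq> [] \<and> hd vs < a) = (ys \<noteq> [])"
      using assms by auto
    with mid Q show ?thesis by auto
  next
    case right
    then have "(us \<noteq> [] \<and> last us < a) = (zs \<noteq> [] \<and> last zs < a)"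
      using assms[of a] by (cases zs rule: rev_cases) auto
    with right Q show ?thesis by (auto simp: letters_of_shape_def)
  qed
next
  fix a assume "a \<in> ?R"
  then consider (left) "a \<in> letters_of_shape Q xs" | (right) "a \<in> letters_of_shape Q ys"
    | (mid) "a = m" "Q (xs \<noteq> []) (ys \<noteq> [])"
    by (auto split: if_splits)
  then show "a \<in> ?L"
  proof cases
    case left
    then obtain us zs where eq: "xs = us @ a # zs"
      and Q: "Q (us \<noteq> [] \<and> last us < a) (zs \<noteq> [] \<and> hd zs < a)"
      by (auto simp: letters_of_shape_def)
    have "(zs @ m # ys \<noteq> [] \<and> hd (zs @ m # ys) < a) = (zs \<noteq> [] \<and> hd zs < a)"
      using assms[of a] eq by (cases zs) auto
    with Q have "Q (us \<noteq> [] \<and> last us < a) (zs @ m # ys \<noteq> [] \<and> hd (zs @ m # ys) < a)"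
      by (simp only:)
    moreover have "xs @ m # ys = us @ a # (zs @ m # ys)" using eq by simp
    ultimately show ?thesis unfolding letters_of_shape_def by blast
  next
    case right
    then obtain zs vs where eq: "ys = zs @ a # vs"
      and Q: "Q (zs \<noteq> [] \<and> last zs < a) (vs \<noteq> [] \<and> hd vs < a)"
      by (auto simp: letters_of_shape_def)
    have "(xs @ m # zs \<noteq> [] \<and> last (xs @ m # zs) < a) = (zs \<noteq> [] \<and> last zs < a)"
      using assms[of a] eq by (cases zs rule: rev_cases) auto
    with Q have "Q (xs @ m # zs \<noteq> [] \<and> last (xs @ m # zs) < a) (vs \<noteq> [] \<and> hd vs < a)"
      by (simp only:)
    moreover have "xs @ m # ys = (xs @ m # zs) @ a # vs" using eq by simp
    ultimately show ?thesis unfolding letters_of_shape_def by blast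
  next
    case mid
    have "(xs \<noteq> [] \<and> last xs < m) = (xs \<noteq> [])" "(ys \<noteq> [] \<and> hd ys < m) = (ys \<noteq> [])"
      using assms by auto
    with mid have "Q (xs \<noteq> [] \<and> last xs < a) (ys \<noteq> [] \<and> hd ys < a)" by (simp only:)
    with mid(1) show ?thesis unfolding letters_of_shape_def by blast
  qed
qed

text \<open>
  The description by positions, which is the one that matches the definitions of \<open>Pin\<close> and
  \<open>Vale\<close>.
\<close>
lemma letters_of_shape_nth:
  "letters_of_shape Q w = {w ! j | j. j < length w \<and>
     Q (0 < j \<and> w ! (j - 1) < w ! j) (Suc j < length w \<and> w ! Suc j < w ! j)}" (is "_ = ?R")
proof (intro equalityI subsetI)
  fix a assume "a \<in> letters_of_shape Q w"
  then obtain xs ys where w: "w = xs @ a # ys"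
    and Q: "Q (xs \<noteq> [] \<and> last xs < a) (ys \<noteq> [] \<and> hd ys < a)"
    by (auto simp: letters_of_shape_def)
  have "(xs \<noteq> [] \<and> last xs < a) = (0 < length xs \<and> w ! (length xs - 1) < w ! length xs)"
    by (auto simp: w last_conv_nth nth_append)
  moreover have "(ys \<noteq> [] \<and> hd ys < a) =
      (Suc (length xs) < length w \<and> w ! Suc (length xs) < w ! length xs)"
    by (auto simp: w hd_conv_nth nth_append)
  ultimately show "a \<in> ?R" using Q w
    by (intro CollectI exI[of _ "length xs"]) (simp only: nth_append_length length_append, simp)
next
  fix a assume "a \<in> ?R"
  then obtain j where j: "a = w ! j" "j < length w"
    and Q: "Q (0 < j \<and> w ! (j - 1) < w ! j) (Suc j < length w \<and> w ! Suc j < w ! j)"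
    by auto
  have split: "w = take j w @ a # drop (Suc j) w"
    using j by (simp add: id_take_nth_drop)
  have "(take j w \<noteq> [] \<and> last (take j w) < a) = (0 < j \<and> w ! (j - 1) < w ! j)"
    using j by (cases "w = []") (auto simp: last_conv_nth min_def)
  moreover have "(drop (Suc j) w \<noteq> [] \<and> hd (drop (Suc j) w) < a) =
      (Suc j < length w \<and> w ! Suc j < w ! j)"
    using j by (auto simp: hd_drop_conv_nth)
  ultimately have "Q (take j w \<noteq> [] \<and> last (take j w) < a)
      (drop (Suc j) w \<noteq> [] \<and> hd (drop (Suc j) w) < a)"
    using Q by (simp only:)
  with split show "a \<in> letters_of_shape Q w"
    unfolding letters_of_shape_def by blast
qed

section \<open>Block systems\<close>

definition block_systems :: "nat \<Rightarrow> nat list set set" where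
  "block_systems k = {B. (\<forall>w\<in>B. w \<noteq> [] \<and> distinct w) \<and>
     (\<forall>w\<in>B. \<forall>w'\<in>B. w \<noteq> w' \<longrightarrow> set w \<inter> set w' = {}) \<and> \<Union> (set ` B) = {1..k}}"

text \<open>
  A site for a new letter is the pair of words that will stand on its left and on its right. The
  empty word marks a side on which no block is attached; a block can serve on one side only.
\<close>
definition sites :: "'a list set \<Rightarrow> ('a list \<times> 'a list) set" where
  "sites B = {(x, y). x \<in> insert [] B \<and> y \<in> insert [] B \<and> (x = y \<longrightarrow> x = [])}"

definition join_at :: "'a \<Rightarrow> 'a list set \<times> 'a list \<times> 'a list \<Rightarrow> 'a list set" where
  "join_at m = (\<lambda>(B, x, y). insert (x @ m # y) (B - {x, y}))"

definition system_shape :: "(bool \<Rightarrow> bool \<Rightarrow> bool) \<Rightarrow> 'a::linorder list set \<Rightarrow> 'a set" where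
  "system_shape Q B = (\<Union>w\<in>B. letters_of_shape Q w)"

lemma block_systemsD:
  assumes "B \<in> block_systems k"
  shows "w \<in> B \<Longrightarrow> w \<noteq> []" "w \<in> B \<Longrightarrow> distinct w" "\<Union> (set ` B) = {1..k}"
  using assms unfolding block_systems_def by blast+

lemma finite_block_systems: "finite (block_systems k)"
  and finite_block_system: "B \<in> block_systems k \<Longrightarrow> finite B"
proof -
  let ?W = "{w. set w \<subseteq> {1..k} \<and> distinct w}"
  have "finite ?W"
    by (rule finite_subset_distinct) simp
  moreover have sub: "B \<subseteq> ?W" if "B \<in> block_systems k" for B
    using block_systemsD[OF that] by blast
  ultimately show "finite (block_systems k)"
    by (meson Pow_iff finite_Pow_iff finite_subset subsetI)
  show "finite B" if "B \<in> block_systems k"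
    using sub[OF that] \<open>finite ?W\<close> by (rule finite_subset)
qed

lemma block_system_letter_le:
  assumes "B \<in> block_systems k" "w \<in> insert [] B" "a \<in> set w"
  shows "1 \<le> a \<and> a \<le> k"
proof -
  have "a \<in> \<Union> (set ` B)" using assms(2,3) by auto
  then have "a \<in> {1..k}" by (simp only: block_systemsD(3)[OF assms(1)])
  then show ?thesis by simp
qed

lemma block_systems_disjoint:
  assumes "B \<in> block_systems k" "v \<in> insert [] B" "w \<in> insert [] B" "v \<noteq> w"
  shows "set v \<inter> set w = {}"
  using assms by (auto simp: block_systems_def)

lemma join_at_in_block_systems:
  assumes B: "B \<in> block_systems k" and xy: "(x, y) \<in> sites B"
  shows "join_at (Suc k) (B, x, y) \<in> block_systems (Suc k)"
proof -
  let ?w = "x @ Suc k # y"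
  have x: "x \<in> insert [] B" and y: "y \<in> insert [] B" and ne: "x = y \<longrightarrow> x = []"
    using xy by (auto simp: sites_def)
  have dist: "distinct v" if "v \<in> insert [] B" for v
    using block_systemsD(2)[OF B] that by auto
  have "set x \<inter> set y = {}"
    using block_systems_disjoint[OF B x y] ne by (cases "x = y") auto
  moreover have "Suc k \<notin> set x" "Suc k \<notin> set y"
    using block_system_letter_le[OF B x, of "Suc k"] block_system_letter_le[OF B y, of "Suc k"]
    by auto
  ultimately have dw: "distinct ?w"
    using dist[OF x] dist[OF y] by simp
  have disj: "set ?w \<inter> set v = {}" if "v \<in> B - {x, y}" for v
  proof -
    have "Suc k \<notin> set v" using block_system_letter_le[OF B, of v "Suc k"] that by auto
    then show ?thesis
      using block_systems_disjoint[OF B x, of v] block_systems_disjoint[OF B y, of v] that by auto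
  qed
  have union: "\<Union> (set ` insert ?w (B - {x, y})) = {1..Suc k}"
  proof -
    have "\<Union> (set ` insert ?w (B - {x, y})) = insert (Suc k) (\<Union> (set ` B))"
      using x y by auto
    also have "\<dots> = insert (Suc k) {1..k}"
      by (simp only: block_systemsD(3)[OF B])
    also have "\<dots> = {1..Suc k}" by auto
    finally show ?thesis .
  qed
  have old: "\<forall>v\<in>B. v \<noteq> [] \<and> distinct v" "\<forall>v\<in>B. \<forall>v'\<in>B. v \<noteq> v' \<longrightarrow> set v \<inter> set v' = {}"
    using B unfolding block_systems_def by blast+
  have "\<forall>v\<in>insert ?w (B - {x, y}). v \<noteq> [] \<and> distinct v"
    using old(1) dw by simp
  moreover have "\<forall>v\<in>insert ?w (B - {x, y}). \<forall>v'\<in>insert ?w (B - {x, y}).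
      v \<noteq> v' \<longrightarrow> set v \<inter> set v' = {}"
  proof (intro ballI impI)
    fix v v' assume "v \<in> insert ?w (B - {x, y})" "v' \<in> insert ?w (B - {x, y})" "v \<noteq> v'"
    then consider "v = ?w" "v' \<in> B - {x, y}" | "v' = ?w" "v \<in> B - {x, y}"
      | "v \<in> B" "v' \<in> B" by (metis DiffD1 insertE)
    then show "set v \<inter> set v' = {}"
    proof cases
      case 1
      then show ?thesis using disj[of v'] by (simp only:)
    next
      case 2
      then show ?thesis using disj[of v] by (simp only: Int_commute)
    next
      case 3
      then show ?thesis using old(2) \<open>v \<noteq> v'\<close> by blast
    qed
  qed
  ultimately show ?thesis
    using union unfolding block_systems_def join_at_def prod.case mem_Collect_eq by (intro conjI)
qed

text \<open>
  The block that contains the new letter and the remaining blocks can be read off from the result;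
  this is what makes an insertion reversible.
\<close>
lemma join_at_parts:
  assumes "m \<notin> \<Union> (set ` B)"
  shows "{w \<in> join_at m (B, x, y). m \<in> set w} = {x @ m # y}"
    and "{w \<in> join_at m (B, x, y). m \<notin> set w} = B - {x, y}"
  using assms by (auto simp: join_at_def)

lemma join_at_inj:
  "inj_on (join_at (Suc k)) (SIGMA B:block_systems k. sites B)"
proof (rule inj_onI)
  fix s s'
  assume s: "s \<in> (SIGMA B:block_systems k. sites B)" "s' \<in> (SIGMA B:block_systems k. sites B)"
    and join: "join_at (Suc k) s = join_at (Suc k) s'"
  obtain B x y B' x' y' where ss: "s = (B, x, y)" "s' = (B', x', y')"
    by (metis prod.exhaust)
  have B: "B \<in> block_systems k" "(x, y) \<in> sites B"
    and B': "B' \<in> block_systems k" "(x', y') \<in> sites B'"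
    using s by (simp_all add: ss)
  have eq: "join_at (Suc k) (B, x, y) = join_at (Suc k) (B', x', y')"
    using join by (simp only: ss)
  have fresh: "Suc k \<notin> \<Union> (set ` B)" "Suc k \<notin> \<Union> (set ` B')"
    unfolding block_systemsD(3)[OF B(1)] block_systemsD(3)[OF B'(1)] by simp_all
  have xy: "x \<in> insert [] B" "y \<in> insert [] B" "x' \<in> insert [] B'" "y' \<in> insert [] B'"
    using B(2) B'(2) by (auto simp: sites_def)
  have "Suc k \<notin> set x" "Suc k \<notin> set y"
    using fresh(1) xy(1,2) by auto
  \<comment> \<open>Both sides are the unique block containing the new letter.\<close>
  moreover have "x @ Suc k # y = x' @ Suc k # y'"
    using join_at_parts(1)[OF fresh(1), of x y] join_at_parts(1)[OF fresh(2), of x' y']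
    unfolding eq by simp
  ultimately have x: "x' = x" "y' = y"
    by (simp_all add: append_Cons_eq_iff)
  have "B - {x, y} = B' - {x, y}"
    using join_at_parts(2)[OF fresh(1), of x y] join_at_parts(2)[OF fresh(2), of x' y']
    unfolding eq x by simp
  moreover have "[] \<notin> B" "[] \<notin> B'"
    using block_systemsD(1)[OF B(1)] block_systemsD(1)[OF B'(1)] by blast+
  ultimately have "B = B'"
    using xy unfolding x by blast
  then show "s = s'" unfolding ss using x by simp
qed

text \<open>
  The preimage is found by deleting the letter \<open>Suc k\<close>, which cuts its block into a left and a
  right part; an empty part must not be kept as a block.
\<close>
lemma join_at_surj:
  assumes B': "B' \<in> block_systems (Suc k)"
  shows "B' \<in> join_at (Suc k) ` (SIGMA B:block_systems k. sites B)"
proof -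
  have props: "\<forall>v\<in>B'. v \<noteq> [] \<and> distinct v"
      "\<forall>v\<in>B'. \<forall>v'\<in>B'. v \<noteq> v' \<longrightarrow> set v \<inter> set v' = {}" "\<Union> (set ` B') = {1..Suc k}"
    using B' unfolding block_systems_def by blast+
  have "Suc k \<in> \<Union> (set ` B')" unfolding props(3) by simp
  then obtain w where w: "w \<in> B'" "Suc k \<in> set w" by auto
  then obtain x y where wxy: "w = x @ Suc k # y" by (meson split_list)
  have dw: "distinct (x @ Suc k # y)"
    using props(1) w(1) unfolding wxy by blast
  define C where "C = B' - {w}"
  define B where "B = C \<union> ({x, y} - {[]})"
  have disj: "set v \<inter> set w = {}" if "v \<in> C" for v
    using props(2) w(1) that by (auto simp: C_def)
  have notin: "x \<notin> C" "y \<notin> C"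
    using disj[of x] disj[of y] props(1) unfolding C_def wxy by auto
  have "\<Union> (set ` B) = {1..k}"
  proof -
    have "\<Union> (set ` B) = \<Union> (set ` C) \<union> (set w - {Suc k})"
      using dw by (auto simp: B_def wxy)
    also have "\<dots> = (\<Union> (set ` C) \<union> set w) - {Suc k}"
      using disj w(2) by blast
    also have "\<Union> (set ` C) \<union> set w = {1..Suc k}"
      using props(3) w(1) unfolding C_def by blast
    finally show ?thesis by auto
  qed
  moreover have "\<forall>v\<in>B. v \<noteq> [] \<and> distinct v"
    using props(1) dw by (auto simp: B_def C_def)
  moreover have "\<forall>v\<in>B. \<forall>v'\<in>B. v \<noteq> v' \<longrightarrow> set v \<inter> set v' = {}"
  proof -
    have cc: "set v \<inter> set v' = {}" if "v \<in> C" "v' \<in> C" "v \<noteq> v'" for v v'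
      using props(2) that by (auto simp: C_def)
    have cx: "set v \<inter> set x = {}" "set v \<inter> set y = {}" if "v \<in> C" for v
      using disj[OF that] by (auto simp: wxy)
    have "set x \<inter> set y = {}" using dw by auto
    then show ?thesis
      unfolding B_def using cc cx by blast
  qed
  ultimately have "B \<in> block_systems k" by (simp add: block_systems_def)
  moreover have "(x, y) \<in> sites B"
    using dw by (auto simp: sites_def B_def)
  moreover have "join_at (Suc k) (B, x, y) = B'"
    using notin w(1) by (auto simp: join_at_def B_def C_def wxy props(1))
  ultimately show ?thesis by force
qed

lemma system_shape_join_at:
  assumes B: "B \<in> block_systems k" and xy: "(x, y) \<in> sites B"
  shows "system_shape Q (join_at (Suc k) (B, x, y)) =
    system_shape Q B \<union> (if Q (x \<noteq> []) (y \<noteq> []) then {Suc k} else {})"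
proof -
  have x: "x \<in> insert [] B" and y: "y \<in> insert [] B"
    using xy by (auto simp: sites_def)
  have "letters_of_shape Q (x @ Suc k # y) = letters_of_shape Q x \<union> letters_of_shape Q y \<union>
      (if Q (x \<noteq> []) (y \<noteq> []) then {Suc k} else {})"
    using block_system_letter_le[OF B x] block_system_letter_le[OF B y]
    by (intro letters_of_shape_split_at_max) (auto simp: less_Suc_eq_le)
  moreover have "system_shape Q B =
      system_shape Q (B - {x, y}) \<union> letters_of_shape Q x \<union> letters_of_shape Q y"
    using x y by (auto simp: system_shape_def)
  ultimately show ?thesis
    by (auto simp: join_at_def system_shape_def)
qed

lemma system_shape_subset:
  assumes "B \<in> block_systems k" shows "system_shape Q B \<subseteq> {1..k}"
  using block_system_letter_le[OF assms] letters_of_shape_subset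
  unfolding system_shape_def by fastforce

section \<open>Counting block systems with prescribed pinnacles and vales\<close>

definition PV_systems :: "nat set \<Rightarrow> nat set \<Rightarrow> nat \<Rightarrow> nat list set set" where
  "PV_systems P V k = {B \<in> block_systems k.
     system_shape peak_shape B = P \<inter> {1..k} \<and> system_shape valley_shape B = V \<inter> {1..k}}"

text \<open>
  The sites at which a new largest letter becomes a pinnacle exactly if \<open>p\<close> holds, and a vale
  exactly if \<open>v\<close> holds.
\<close>
definition PV_sites :: "bool \<Rightarrow> bool \<Rightarrow> 'a list set \<Rightarrow> ('a list \<times> 'a list) set" where
  "PV_sites p v B = {(x, y) \<in> sites B. (p \<longleftrightarrow> x \<noteq> [] \<and> y \<noteq> []) \<and> (v \<longleftrightarrow> x = [] \<and> y = [])}"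

text \<open>
  Comparing the shapes after an insertion with \<open>S\<close> amounts to comparing them before the insertion,
  and comparing the new letter separately.
\<close>
lemma Un_singleton_eq_Int_insert_iff:
  assumes "X \<subseteq> I" "m \<notin> I"
  shows "X \<union> (if c then {m} else {}) = S \<inter> insert m I \<longleftrightarrow> X = S \<inter> I \<and> (m \<in> S \<longleftrightarrow> c)"
    (is "?L = ?R \<longleftrightarrow> ?Q")
proof
  assume eq: "?L = ?R"
  have "X = ?L - {m}" using assms by auto
  also have "\<dots> = S \<inter> I" unfolding eq using assms(2) by blast
  finally have "X = S \<inter> I" .
  moreover have "m \<in> ?L \<longleftrightarrow> c" using assms by auto
  then have "m \<in> S \<longleftrightarrow> c" unfolding eq by simp
  ultimately show ?Q by blast
next
  assume ?Q
  then show "?L = ?R" by (cases c) auto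
qed

lemma PV_systems_Suc:
  "bij_betw (join_at (Suc k))
     (SIGMA B:PV_systems P V k. PV_sites (Suc k \<in> P) (Suc k \<in> V) B) (PV_systems P V (Suc k))"
proof -
  have restrict: "X \<union> (if c then {Suc k} else {}) = S \<inter> {1..Suc k} \<longleftrightarrow>
      X = S \<inter> {1..k} \<and> (Suc k \<in> S \<longleftrightarrow> c)" if "X \<subseteq> {1..k}" for X S :: "nat set" and c
  proof -
    have "{1..Suc k} = insert (Suc k) {1..k}" by auto
    then show ?thesis
      using Un_singleton_eq_Int_insert_iff[OF that, of "Suc k" c S] by simp
  qed
  have iff: "join_at (Suc k) (B, x, y) \<in> PV_systems P V (Suc k) \<longleftrightarrow>
      B \<in> PV_systems P V k \<and> (x, y) \<in> PV_sites (Suc k \<in> P) (Suc k \<in> V) B"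
    if "B \<in> block_systems k" "(x, y) \<in> sites B" for B x y
  proof -
    have shape: "system_shape Q (join_at (Suc k) (B, x, y)) = S \<inter> {1..Suc k} \<longleftrightarrow>
        system_shape Q B = S \<inter> {1..k} \<and> (Suc k \<in> S \<longleftrightarrow> Q (x \<noteq> []) (y \<noteq> []))" for Q S
      unfolding system_shape_join_at[OF that]
      by (rule restrict[OF system_shape_subset[OF that(1)]])
    show ?thesis
      unfolding PV_systems_def PV_sites_def mem_Collect_eq prod.case shape
      by (simp only: that join_at_in_block_systems[OF that] simp_thms conj_ac)
  qed
  have sub: "(SIGMA B:PV_systems P V k. PV_sites (Suc k \<in> P) (Suc k \<in> V) B)
      \<subseteq> (SIGMA B:block_systems k. sites B)"
    by (auto simp: PV_systems_def PV_sites_def)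
  show ?thesis
    unfolding bij_betw_def
  proof (intro conjI equalityI subsetI)
    show "inj_on (join_at (Suc k)) (SIGMA B:PV_systems P V k. PV_sites (Suc k \<in> P) (Suc k \<in> V) B)"
      using join_at_inj sub by (rule inj_on_subset)
  next
    fix B' assume "B' \<in> join_at (Suc k) ` (SIGMA B:PV_systems P V k. PV_sites (Suc k \<in> P) (Suc k \<in> V) B)"
    then obtain B x y where B: "B \<in> PV_systems P V k"
      and xy: "(x, y) \<in> PV_sites (Suc k \<in> P) (Suc k \<in> V) B" and B': "B' = join_at (Suc k) (B, x, y)"
      by auto
    have "B \<in> block_systems k" "(x, y) \<in> sites B"
      using B xy by (simp_all add: PV_systems_def PV_sites_def)
    from iff[OF this] B xy show "B' \<in> PV_systems P V (Suc k)"
      unfolding B' by simp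
  next
    fix B' assume B': "B' \<in> PV_systems P V (Suc k)"
    then have "B' \<in> join_at (Suc k) ` (SIGMA B:block_systems k. sites B)"
      by (intro join_at_surj) (simp add: PV_systems_def)
    then obtain B x y where B: "B \<in> block_systems k" "(x, y) \<in> sites B"
      and eq: "B' = join_at (Suc k) (B, x, y)"
      by auto
    from iff[OF B] B' have "(B, x, y) \<in> (SIGMA B:PV_systems P V k. PV_sites (Suc k \<in> P) (Suc k \<in> V) B)"
      unfolding eq by simp
    with eq show "B' \<in> join_at (Suc k) ` (SIGMA B:PV_systems P V k. PV_sites (Suc k \<in> P) (Suc k \<in> V) B)"
      by (rule image_eqI)
  qed
qed

lemma N_PV_Suc:
  assumes "finite P" "finite V"
  shows "N_PV P V (Suc k) =
    N_PV P V k + (if k \<in> V then 1 else 0) - (if k \<in> P then 1 else 0)"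
proof -
  have "{s \<in> S. s < Suc k} = (if k \<in> S then insert k {s \<in> S. s < k} else {s \<in> S. s < k})"
    for S :: "nat set"
    by (auto simp: less_Suc_eq)
  then have "int (card {s \<in> S. s < Suc k}) = int (card {s \<in> S. s < k}) + (if k \<in> S then 1 else 0)"
    if "finite S" for S :: "nat set"
    using that by simp
  then show ?thesis using assms by (simp add: N_PV_def)
qed

text \<open>
  The nonempty words of the site are removed and one block is added. There are two, one or no
  nonempty words in the site according to the shape of the new letter.
\<close>
lemma card_join_at:
  assumes B: "B \<in> block_systems k" and xy: "(x, y) \<in> sites B"
  shows "int (card (join_at (Suc k) (B, x, y))) =
    int (card B) + (if x = [] \<and> y = [] then 1 else 0) - (if x \<noteq> [] \<and> y \<noteq> [] then 1 else 0)"
proof -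
  have fin: "finite B" using B by (rule finite_block_system)
  have "x @ Suc k # y \<notin> B - {x, y}"
    using block_system_letter_le[OF B, of "x @ Suc k # y" "Suc k"] by auto
  then have "card (join_at (Suc k) (B, x, y)) = Suc (card (B - {x, y}))"
    using fin by (simp add: join_at_def)
  moreover have "B - {x, y} = B - ({x, y} - {[]})"
    using B by (auto simp: block_systems_def)
  moreover have "{x, y} - {[]} \<subseteq> B" using xy by (auto simp: sites_def)
  then have "int (card (B - ({x, y} - {[]}))) = int (card B) - int (card ({x, y} - {[]}))"
    using fin by (simp add: card_Diff_subset finite_subset of_nat_diff card_mono)
  moreover have "int (card ({x, y} - {[]})) =
      1 - (if x = [] \<and> y = [] then 1 else 0) + (if x \<noteq> [] \<and> y \<noteq> [] then 1 else 0)"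
    using xy by (auto simp: sites_def insert_Diff_if)
  ultimately show ?thesis by simp
qed

text \<open>
  All systems with the same pinnacles and vales have equally many blocks. The argument of \<open>N_PV\<close>
  is \<open>Suc k\<close> because \<open>N_PV\<close> counts strictly smaller letters.
\<close>
lemma card_PV_system:
  assumes fin: "finite P" "finite V" and P0: "0 \<notin> P" and V0: "0 \<notin> V"
    and B: "B \<in> PV_systems P V k"
  shows "int (card B) = N_PV P V (Suc k)"
  using B
proof (induction k arbitrary: B)
  case 0
  then have "B = {}" by (force simp: PV_systems_def block_systems_def)
  moreover have "{p \<in> P. p < Suc 0} = {}" "{v \<in> V. v < Suc 0} = {}"
    using P0 V0 by auto
  ultimately show ?case by (simp only: N_PV_def card.empty)
next
  case (Suc k)
  then have "B \<in> join_at (Suc k) ` (SIGMA A:PV_systems P V k. PV_sites (Suc k \<in> P) (Suc k \<in> V) A)"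
    by (simp only: bij_betw_imp_surj_on[OF PV_systems_Suc])
  then obtain A x y where A: "A \<in> PV_systems P V k"
    and xy: "(x, y) \<in> PV_sites (Suc k \<in> P) (Suc k \<in> V) A" and "B = join_at (Suc k) (A, x, y)" by auto
  moreover have "A \<in> block_systems k" "(x, y) \<in> sites A"
    using A xy by (auto simp: PV_systems_def PV_sites_def)
  ultimately have "int (card B) =
      int (card A) + (if Suc k \<in> V then 1 else 0) - (if Suc k \<in> P then 1 else 0)"
    using card_join_at[of A k x y] by (simp add: PV_sites_def)
  with Suc.IH[OF A] show ?case
    using N_PV_Suc[OF fin, of "Suc k"] by simp
qed

definition site_count :: "bool \<Rightarrow> bool \<Rightarrow> int \<Rightarrow> int" where
  "site_count p v N = (if v then 1 else if p then N * (N - 1) else 2 * N)"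

lemma card_PV_sites:
  assumes fin: "finite B" and ne: "[] \<notin> B" and pv: "\<not> (p \<and> v)"
  shows "finite (PV_sites p v B)"
    and "int (card (PV_sites p v B)) = site_count p v (int (card B))"
proof -
  have "PV_sites p v B \<subseteq> insert [] B \<times> insert [] B"
    by (auto simp: PV_sites_def sites_def)
  then show "finite (PV_sites p v B)"
    by (rule finite_subset) (use fin in simp)
  consider v | p "\<not> v" | "\<not> p" "\<not> v" by blast
  then show "int (card (PV_sites p v B)) = site_count p v (int (card B))"
  proof cases
    case 1
    then have "PV_sites p v B = {([], [])}"
      using pv by (auto simp: PV_sites_def sites_def)
    then show ?thesis using 1 by (simp add: site_count_def)
  next
    case 2
    then have "PV_sites p v B = B \<times> B - (\<lambda>w. (w, w)) ` B"
      using ne by (auto simp: PV_sites_def sites_def)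
    moreover have "card ((\<lambda>w. (w, w)) ` B) = card B"
      by (intro card_image inj_onI) simp
    moreover have "(\<lambda>w. (w, w)) ` B \<subseteq> B \<times> B" by auto
    ultimately have "int (card (PV_sites p v B)) = int (card B) * int (card B) - int (card B)"
      using fin by (simp add: card_Diff_subset card_cartesian_product of_nat_diff)
    then show ?thesis using 2 by (simp add: site_count_def algebra_simps)
  next
    case 3
    then have "PV_sites p v B = B \<times> {[]} \<union> {[]} \<times> B"
      using ne by (auto simp: PV_sites_def sites_def)
    moreover have "(B \<times> {[]}) \<inter> ({[]} \<times> B) = {}" using ne by auto
    ultimately have "card (PV_sites p v B) = 2 * card B"
      using fin by (simp add: card_Un_disjoint card_cartesian_product)
    then show ?thesis using 3 by (simp add: site_count_def)
  qed
qed

text \<open>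
  The number of sites is the same for all systems with letters up to \<open>k\<close>, so the numbers of
  choices multiply.
\<close>
lemma card_PV_systems:
  assumes fin: "finite P" "finite V" and P0: "0 \<notin> P" and V0: "0 \<notin> V" and disj: "P \<inter> V = {}"
  shows "int (card (PV_systems P V k)) = (\<Prod>m=1..k. site_count (m \<in> P) (m \<in> V) (N_PV P V m))"
proof (induction k)
  case 0
  have "block_systems 0 = {{}}" by (force simp: block_systems_def)
  then have "PV_systems P V 0 = {{}}" by (auto simp: PV_systems_def system_shape_def)
  then show ?case by simp
next
  case (Suc k)
  let ?S = "PV_sites (Suc k \<in> P) (Suc k \<in> V)"
  have sites: "finite (?S B)"
    "int (card (?S B)) = site_count (Suc k \<in> P) (Suc k \<in> V) (N_PV P V (Suc k))"
    if B: "B \<in> PV_systems P V k" for B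
  proof -
    have "B \<in> block_systems k" using B by (simp add: PV_systems_def)
    then have "finite B" "[] \<notin> B"
      by (auto simp: block_systems_def intro: finite_block_system)
    moreover have "\<not> (Suc k \<in> P \<and> Suc k \<in> V)" using disj by auto
    ultimately show "finite (?S B)"
      "int (card (?S B)) = site_count (Suc k \<in> P) (Suc k \<in> V) (N_PV P V (Suc k))"
      using card_PV_sites[of B "Suc k \<in> P" "Suc k \<in> V"] card_PV_system[OF fin P0 V0 B] by auto
  qed
  have "finite (PV_systems P V k)"
    using finite_block_systems by (rule finite_subset[rotated]) (auto simp: PV_systems_def)
  then have "int (card (PV_systems P V (Suc k))) = (\<Sum>B\<in>PV_systems P V k. int (card (?S B)))"
    using bij_betw_same_card[OF PV_systems_Suc[of k P V]] sites(1)
    by (simp add: card_SigmaI flip: of_nat_sum)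
  also have "\<dots> = int (card (PV_systems P V k)) * site_count (Suc k \<in> P) (Suc k \<in> V) (N_PV P V (Suc k))"
    using sites(2) by simp
  finally show ?case using Suc.IH by simp
qed

section \<open>Permutations as systems with a single block\<close>

definition word :: "nat \<Rightarrow> (nat \<Rightarrow> nat) \<Rightarrow> nat list" where
  "word n \<pi> = map \<pi> [1..<Suc n]"

text \<open>
  The letters of a permutation are distinct, so "not smaller" and "larger" agree for neighbours;
  this identifies vales with the letters that have no smaller neighbour.
\<close>
lemma word_shapes:
  assumes \<pi>: "\<pi> permutes {1..n}"
  shows "Pin n \<pi> = letters_of_shape peak_shape (word n \<pi>)"
    and "Vale n \<pi> = letters_of_shape valley_shape (word n \<pi>)"
proof -
  have len: "length (word n \<pi>) = n" by (simp add: word_def)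
  have nth: "word n \<pi> ! j = \<pi> (Suc j)" if "j < n" for j
    using that by (simp add: word_def del: upt_Suc)
  have pos: "{\<pi> i |i. i \<in> {1..n} \<and> R i} = {word n \<pi> ! j |j. j < n \<and> R (Suc j)}" for R
  proof -
    have "(\<exists>i. a = \<pi> i \<and> i \<in> {1..n} \<and> R i) \<longleftrightarrow> (\<exists>j. a = \<pi> (Suc j) \<and> j < n \<and> R (Suc j))"
      (is "?A \<longleftrightarrow> ?B") for a
    proof
      assume ?A
      then obtain i where "a = \<pi> i" "i \<in> {1..n}" "R i" by blast
      then show ?B by (intro exI[of _ "i - 1"]) auto
    next
      assume ?B
      then obtain j where "a = \<pi> (Suc j)" "j < n" "R (Suc j)" by blast
      then show ?A by (intro exI[of _ "Suc j"]) auto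
    qed
    then have "{\<pi> i |i. i \<in> {1..n} \<and> R i} = {\<pi> (Suc j) |j. j < n \<and> R (Suc j)}"
      by (simp only:)
    also have "\<dots> = {word n \<pi> ! j |j. j < n \<and> R (Suc j)}"
      by (intro Collect_cong ex_cong1) (metis nth)
    finally show ?thesis .
  qed
  have ne: "\<pi> a \<noteq> \<pi> b" if "a \<noteq> b" for a b
    using permutes_inj[OF \<pi>] that by (auto dest: injD)
  have left: "letter n \<pi> (Suc j - 1) < letter n \<pi> (Suc j) \<longleftrightarrow>
      0 < j \<and> word n \<pi> ! (j - 1) < word n \<pi> ! j"
    "letter n \<pi> (Suc j - 1) > letter n \<pi> (Suc j) \<longleftrightarrow>
      \<not> (0 < j \<and> word n \<pi> ! (j - 1) < word n \<pi> ! j)" if "j < n" for j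
    using that nth[of j] nth[of "j - 1"] ne[of j "Suc j"] by (auto simp: letter_def)
  have right: "letter n \<pi> (Suc j + 1) < letter n \<pi> (Suc j) \<longleftrightarrow>
      Suc j < n \<and> word n \<pi> ! Suc j < word n \<pi> ! j"
    "letter n \<pi> (Suc j + 1) > letter n \<pi> (Suc j) \<longleftrightarrow>
      \<not> (Suc j < n \<and> word n \<pi> ! Suc j < word n \<pi> ! j)" if "j < n" for j
    using that nth[of j] nth[of "Suc j"] ne[of "Suc j" "Suc (Suc j)"] by (auto simp: letter_def)
  show "Pin n \<pi> = letters_of_shape peak_shape (word n \<pi>)"
    unfolding Pin_def pos letters_of_shape_nth len
    by (intro Collect_cong ex_cong1 conj_cong refl) (simp_all only: left right)
  show "Vale n \<pi> = letters_of_shape valley_shape (word n \<pi>)"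
    unfolding Vale_def pos letters_of_shape_nth len
    by (intro Collect_cong ex_cong1 conj_cong refl) (simp_all only: left right)
qed

lemma set_word: "set (word n \<pi>) = \<pi> ` {1..n}"
  by (simp add: word_def atLeastLessThanSuc_atLeastAtMost del: upt_Suc)

lemma singleton_word_PV_system:
  assumes "n \<ge> 1" "\<pi> permutes {1..n}"
  shows "{word n \<pi>} \<in> PV_systems (Pin n \<pi>) (Vale n \<pi>) n"
proof -
  have set: "set (word n \<pi>) = {1..n}"
    unfolding set_word by (rule permutes_image[OF assms(2)])
  moreover have "distinct (word n \<pi>)"
    unfolding word_def distinct_map
    using inj_on_subset[OF permutes_inj[OF assms(2)]] by (simp del: upt_Suc)
  moreover have "word n \<pi> \<noteq> []" using set assms(1) by auto
  ultimately have "{word n \<pi>} \<in> block_systems n" by (simp add: block_systems_def)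
  moreover have "letters_of_shape Q (word n \<pi>) \<inter> {1..n} = letters_of_shape Q (word n \<pi>)" for Q
    using letters_of_shape_subset[of Q "word n \<pi>"] unfolding set by (rule Int_absorb2)
  ultimately show ?thesis
    by (simp only: PV_systems_def word_shapes[OF assms(2)] system_shape_def mem_Collect_eq
        UN_singleton UN_insert UN_empty Un_empty_right simp_thms)
qed

lemma word_surj:
  assumes "distinct w" "set w = {1..n}"
  obtains \<pi> where "\<pi> permutes {1..n}" "word n \<pi> = w"
proof -
  have len: "length w = n" using assms distinct_card[of w] by simp
  define \<pi> where "\<pi> i = (if i \<in> {1..n} then w ! (i - 1) else i)" for i
  have w: "word n \<pi> = w"
    by (rule nth_equalityI) (auto simp: word_def len \<pi>_def simp del: upt_Suc)
  have img: "\<pi> ` {1..n} = {1..n}" using set_word[of n \<pi>] unfolding w assms(2) by (rule sym)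
  then have "inj_on \<pi> {1..n}" by (intro eq_card_imp_inj_on) auto
  then have "\<pi> permutes {1..n}"
    using img by (intro bij_imp_permutes) (simp_all only: bij_betw_def \<pi>_def if_False simp_thms)
  with w show ?thesis using that by blast
qed

lemma finite_subset_positive:
  assumes "S \<subseteq> {1..n::nat}"
  shows "finite S" "0 \<notin> S" "{s \<in> S. s < Suc n} = S"
  using assms finite_subset[OF assms] by auto

text \<open>
  The assumption on cardinalities says that \<open>N_PV P V (Suc n) = 1\<close>: a system that uses all
  letters then consists of one word, which is the one-line notation of a permutation.
\<close>
lemma card_perms_with_Pin_Vale:
  assumes n: "n \<ge> 1" and P: "P \<subseteq> {1..n}" and V: "V \<subseteq> {1..n} - P"
    and card: "card V = Suc (card P)"
  shows "card {\<pi>. \<pi> permutes {1..n} \<and> Pin n \<pi> = P \<and> Vale n \<pi> = V} = card (PV_systems P V n)"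
proof -
  let ?Perms = "{\<pi>. \<pi> permutes {1..n} \<and> Pin n \<pi> = P \<and> Vale n \<pi> = V}"
  have "bij_betw (\<lambda>\<pi>. {word n \<pi>}) ?Perms (PV_systems P V n)"
    unfolding bij_betw_def
  proof (intro conjI equalityI subsetI)
    show "inj_on (\<lambda>\<pi>. {word n \<pi>}) ?Perms"
    proof (rule inj_onI)
      fix \<pi> \<sigma> assume *: "\<pi> \<in> ?Perms" "\<sigma> \<in> ?Perms" "{word n \<pi>} = {word n \<sigma>}"
      then have "\<pi> i = \<sigma> i" if "i \<in> {1..n}" for i
        using that *(3) by (simp add: word_def del: upt_Suc)
      moreover have "\<pi> i = \<sigma> i" if "i \<notin> {1..n}" for i
        using *(1,2) that permutes_not_in[of \<pi> "{1..n}" i] permutes_not_in[of \<sigma> "{1..n}" i]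
        by simp
      ultimately show "\<pi> = \<sigma>" by blast
    qed
  next
    fix B assume "B \<in> (\<lambda>\<pi>. {word n \<pi>}) ` ?Perms"
    then obtain \<pi> where "\<pi> permutes {1..n}" "Pin n \<pi> = P" "Vale n \<pi> = V" "B = {word n \<pi>}"
      by auto
    with singleton_word_PV_system[OF n] show "B \<in> PV_systems P V n" by metis
  next
    fix B assume B: "B \<in> PV_systems P V n"
    have "V \<subseteq> {1..n}" using V by blast
    note p = finite_subset_positive[OF P] and v = finite_subset_positive[OF this]
    have "N_PV P V (Suc n) = 1" using card by (simp add: N_PV_def p(3) v(3))
    then have "card B = 1"
      using card_PV_system[OF p(1) v(1) p(2) v(2) B] by simp
    then obtain w where w: "B = {w}" by (auto simp: card_1_singleton_iff)
    have "{w} \<in> block_systems n" using B by (simp add: w PV_systems_def)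
    from block_systemsD[OF this] have "distinct w" "set w = {1..n}" by auto
    then obtain \<pi> where \<pi>: "\<pi> permutes {1..n}" "word n \<pi> = w" by (rule word_surj)
    have "letters_of_shape peak_shape w = P \<inter> {1..n}" "letters_of_shape valley_shape w = V \<inter> {1..n}"
      using B by (simp_all add: w PV_systems_def system_shape_def)
    then have "Pin n \<pi> = P" "Vale n \<pi> = V"
      using P \<open>V \<subseteq> {1..n}\<close> unfolding word_shapes[OF \<pi>(1)] \<pi>(2) by blast+
    then have "\<pi> \<in> ?Perms" using \<pi>(1) by simp
    then show "B \<in> (\<lambda>\<pi>. {word n \<pi>}) ` ?Perms" by (rule rev_image_eqI) (simp only: w \<pi>(2))
  qed
  then show ?thesis by (rule bij_betw_same_card)
qed

lemma Pin_Vale_subset: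
  assumes "\<pi> permutes {1..n}"
  shows "Pin n \<pi> \<subseteq> {1..n}" "Vale n \<pi> \<subseteq> {1..n}"
proof -
  have "\<pi> i \<in> {1..n}" if "i \<in> {1..n}" for i
    using that permutes_in_image[OF assms] by blast
  then show "Pin n \<pi> \<subseteq> {1..n}" "Vale n \<pi> \<subseteq> {1..n}"
    unfolding Pin_def Vale_def by blast+
qed

lemma Vale_disjoint_Pin:
  assumes "\<pi> permutes {1..n}"
  shows "Vale n \<pi> \<inter> Pin n \<pi> = {}"
proof (rule ccontr)
  assume "Vale n \<pi> \<inter> Pin n \<pi> \<noteq> {}"
  then obtain i j where "\<pi> i = \<pi> j" "letter n \<pi> i < letter n \<pi> (i + 1)"
    "letter n \<pi> j > letter n \<pi> (j + 1)"
    unfolding Pin_def Vale_def by blast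
  moreover from this have "i = j" using permutes_inj[OF assms] by (simp add: inj_eq)
  ultimately show False by simp
qed

text \<open>
  The word of a permutation is a system with exactly one block, and its number of blocks is the
  number of vales minus the number of pinnacles.
\<close>
lemma card_Vale:
  assumes "n \<ge> 1" "\<pi> permutes {1..n}"
  shows "card (Vale n \<pi>) = Suc (card (Pin n \<pi>))"
proof -
  note pin = finite_subset_positive[OF Pin_Vale_subset(1)[OF assms(2)]]
    and vale = finite_subset_positive[OF Pin_Vale_subset(2)[OF assms(2)]]
  have "int (card {word n \<pi>}) = N_PV (Pin n \<pi>) (Vale n \<pi>) (Suc n)"
    using pin(1) vale(1) pin(2) vale(2) singleton_word_PV_system[OF assms] by (rule card_PV_system)
  then show ?thesis by (simp add: N_PV_def pin(3) vale(3))
qed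

section \<open>The pinnacle formula\<close>

text \<open>
  Vales contribute the factor \<open>1\<close> and each of the other \<open>n - card V\<close> letters contributes one
  factor \<open>2\<close>; for a pinnacle it comes from \<open>N (N - 1) = 2 * (N choose 2)\<close>.
\<close>
lemma prod_site_count:
  fixes f :: "nat \<Rightarrow> int"
  assumes P: "P \<subseteq> {1..n}" and V: "V \<subseteq> {1..n} - P" and card: "card V = Suc (card P)"
  shows "real_of_int (\<Prod>m=1..n. site_count (m \<in> P) (m \<in> V) (f m)) =
    2 ^ (n - card P - 1) * ((\<Prod>p\<in>P. real_of_int (f p) gchoose 2) *
      (\<Prod>x\<in>{1..n} - (P \<union> V). real_of_int (f x)))"
proof -
  let ?g = "\<lambda>m. real_of_int (site_count (m \<in> P) (m \<in> V) (f m))" and ?X = "{1..n} - (P \<union> V)"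
  have "V \<subseteq> {1..n}" using V by blast
  then have fin: "finite P" "finite V" "finite ?X"
    using finite_subset_positive(1)[OF P] finite_subset_positive(1) by simp_all
  have un: "{1..n} = V \<union> (P \<union> ?X)" using P V by auto
  have "card {1..n} = card V + (card P + card ?X)"
  proof -
    have "card (V \<union> (P \<union> ?X)) = card V + (card P + card ?X)"
      using fin V by (subst card_Un_disjoint, auto)+
    then show ?thesis using un by simp
  qed
  then have exp: "n - card P - 1 = card P + card ?X" using card by simp
  have "(\<Prod>m=1..n. ?g m) = prod ?g V * (prod ?g P * prod ?g ?X)"
  proof -
    have "prod ?g (V \<union> (P \<union> ?X)) = prod ?g V * prod ?g (P \<union> ?X)"
      using fin V by (intro prod.union_disjoint) auto
    also have "prod ?g (P \<union> ?X) = prod ?g P * prod ?g ?X"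
      using fin by (intro prod.union_disjoint) auto
    finally show ?thesis using un by simp
  qed
  moreover have "prod ?g V = 1"
    by (rule prod.neutral) (simp add: site_count_def)
  moreover have "prod ?g P = (\<Prod>p\<in>P. 2 * (real_of_int (f p) gchoose 2))"
    using V by (intro prod.cong) (auto simp: site_count_def gbinomial_prod_rev numeral_2_eq_2)
  moreover have "prod ?g ?X = (\<Prod>x\<in>?X. 2 * real_of_int (f x))"
    by (intro prod.cong) (auto simp: site_count_def)
  ultimately show ?thesis
    using fin unfolding exp by (simp add: prod.distrib power_add)
qed

theorem theorem1p3:
  fixes n :: nat and P :: "nat set"
  assumes "n \<ge> 1" and "admissible n P"
  shows "real (card (Pin_perms P n)) =
    2 ^ (n - card P - 1) *
    (\<Sum>V\<in>vale_sets n P.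
       (\<Prod>p\<in>P. real_of_int (N_PV P V p) gchoose 2) *
       (\<Prod>x\<in>{1..n} - (P \<union> V). real_of_int (N_PV P V x)))"
proof -
  let ?Perms = "\<lambda>V. {\<pi>. \<pi> permutes {1..n} \<and> Pin n \<pi> = P \<and> Vale n \<pi> = V}"
  have P: "P \<subseteq> {1..n}" using assms(2) by (simp add: admissible_def)
  have count: "real (card (?Perms V)) = 2 ^ (n - card P - 1) *
      ((\<Prod>p\<in>P. real_of_int (N_PV P V p) gchoose 2) *
       (\<Prod>x\<in>{1..n} - (P \<union> V). real_of_int (N_PV P V x)))" if "V \<in> vale_sets n P" for V
  proof -
    have V: "V \<subseteq> {1..n} - P" using that by (simp add: vale_sets_def)
    have card: "card V = Suc (card P)"
      using that card_Vale[OF assms(1)] by (auto simp: vale_sets_def)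
    have "V \<subseteq> {1..n}" "P \<inter> V = {}" using V by blast+
    note p = finite_subset_positive[OF P] and v = finite_subset_positive[OF this(1)]
    note systems = card_PV_systems[OF p(1) v(1) p(2) v(2) \<open>P \<inter> V = {}\<close>, of n]
    have "real (card (?Perms V)) = real_of_int (int (card (PV_systems P V n)))"
      using card_perms_with_Pin_Vale[OF assms(1) P V card] by simp
    also have "\<dots> = 2 ^ (n - card P - 1) *
      ((\<Prod>p\<in>P. real_of_int (N_PV P V p) gchoose 2) *
       (\<Prod>x\<in>{1..n} - (P \<union> V). real_of_int (N_PV P V x)))"
      unfolding systems by (rule prod_site_count[OF P V card])
    finally show ?thesis .
  qed
  have "Vale n \<pi> \<in> vale_sets n P" if "\<pi> permutes {1..n}" "Pin n \<pi> = P" for \<pi>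
    using that Vale_disjoint_Pin[OF that(1)] Pin_Vale_subset(2)[OF that(1)]
    unfolding vale_sets_def by blast
  then have union: "Pin_perms P n = (\<Union>V\<in>vale_sets n P. ?Perms V)"
    unfolding Pin_perms_def by blast
  have "vale_sets n P \<subseteq> Pow {1..n}"
    unfolding vale_sets_def by blast
  then have "finite (vale_sets n P)"
    by (rule finite_subset) simp
  moreover have "finite (?Perms V)" for V
    by (rule finite_subset[OF _ finite_permutations[of "{1..n}"]]) auto
  moreover have "?Perms V \<inter> ?Perms W = {}" if "V \<noteq> W" for V W
    using that by blast
  ultimately have "card (\<Union>V\<in>vale_sets n P. ?Perms V) = (\<Sum>V\<in>vale_sets n P. card (?Perms V))"
    by (intro card_UN_disjoint ballI impI)
  then have "real (card (Pin_perms P n)) = (\<Sum>V\<in>vale_sets n P. real (card (?Perms V)))"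
    unfolding union by (simp only: of_nat_sum)
  also have "\<dots> = (\<Sum>V\<in>vale_sets n P. 2 ^ (n - card P - 1) *
      ((\<Prod>p\<in>P. real_of_int (N_PV P V p) gchoose 2) *
       (\<Prod>x\<in>{1..n} - (P \<union> V). real_of_int (N_PV P V x))))"
    using count by (rule sum.cong[OF refl])
  finally show ?thesis
    unfolding sum_distrib_left .
qed

end
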